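(* Let $(\mathbb{X},\perp)$ be a $\perp$-restriction category, and let $f:X\to X$ and $g:X\to A$ be maps with $f\perp g$. Then for all $n,m\in\mathbb{N}$ with $n\ne m$, $f^ng\perp f^mg$ (where $f^0=1_X$). Furthermore, if $(\mathbb{X},\circledast)$ is a $\perp$-itegory, then for all $n\in\mathbb{N}$, $$f\circledast g=g\sqcup fg\sqcup f^2g\sqcup\dots\sqcup f^ng\sqcup f^{n+1}(f\circledast g),$$ i.e. $f\circledast g$ is the $\perp$-join of the family $\{g,fg,\dots,f^ng,f^{n+1}(f\circledast g)\}$. In particular, $f^ng\le f\circledast g$ for all $n\in\mathbb{N}$.
   Context: Composition is diagrammatic: $fg$ means first $f$, then $g$. A restriction category is a category with an operator sending each $f:A\to B$ to $\overline{f}:A\to A$ such that $\overline{f}f=f$; $\overline{f}\,\overline{g}=\overline{g}\,\overline{f}$ and $\overline{\overline{g}f}=\overline{g}\,\overline{f}$ for $f:A\to B$, $g:A\to C$; and $f\overline{g}=\overline{fg}f$ for $f:A\to B$, $g:B\to C$. For parallel $f,g$: $f\le g$ iff $\overline{f}g=f$ (a partial order). Restriction zeroes: maps $0:A\to B$ with $f0=0=0f$ and $\overline{0}=0$. An interference relation $\perp$ on a restriction category with restriction zeroes is a family of relations between maps with the same domain such that: $1_A\perp 0$; $f\perp g\Rightarrow g\perp f$; $f\perp f\Rightarrow f=0$; $f'\perp g'$, $f\le f'$, $g\le g'$ imply $f\perp g$; $f\perp g\Rightarrow hfk\perp hgk'$ for all composable $h,k,k'$; $f\perp g\Rightarrow\overline{f}\perp\overline{g}$.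 A $\perp$-restriction category is a restriction category with restriction zeroes and a chosen interference relation $\perp$. The $\perp$-join (written with $\sqcup$) of a family of parallel pairwise $\perp$-disjoint maps is their least upper bound for $\le$, if it exists. $\mathbb{X}$ has all binary $\perp$-joins if $f\sqcup g$ exists for all parallel $f\perp g$ and $h(f\sqcup g)=hf\sqcup hg$ for all composable $h$. A Kleene wand $\circledast$ on a $\perp$-restriction category with all binary $\perp$-joins assigns to each $f:X\to X$, $g:X\to A$ with $f\perp g$ a map $f\circledast g:X\to A$ such that: (1) if $f \perp g$, then $g\sqcup f(f\circledast g)=f\circledast g$; (2) $(f\circledast g)h=f\circledast gh$ for $f\perp g$, $h:A\to B$; (3) for $f:X\to Y$, $g:X\to A$, $k:Y\to X$ with $f\perp g$: $kf\circledast kg=k(fk\circledast g)$; (4) for $f,f':X\to X$, $g:X\to A$ with $f\perp f'$ and $f\sqcup f'\perp g$: $(f\circledast f')\perp(f\circledast g)$ and $(f\sqcup f')\circledast g=(f\circledast f')\circledast(f\circledast g)$. A $\perp$-itegory is a $\perp$-restriction category with all binary $\perp$-joins and a Kleene wand. *)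

theory Defs
  imports Main
begin

(* Composition is diagrammatic: in f \<Zcomp> g the map f comes first. *)

record ('o, 'm) cat_data =
  Obj :: "'o set"
  Arr :: "'m set"
  Dom :: "'m \<Rightarrow> 'o"
  Cod :: "'m \<Rightarrow> 'o"
  Id :: "'o \<Rightarrow> 'm"
  Comp :: "'m \<Rightarrow> 'm \<Rightarrow> 'm"  (infixl "\<Zcomp>\<index>" 70)

definition hom :: "('o, 'm, 'x) cat_data_scheme \<Rightarrow> 'o \<Rightarrow> 'o \<Rightarrow> 'm set" where
  "hom C A B = {f \<in> Arr C. Dom C f = A \<and> Cod C f = B}"

primrec mpow :: "('o, 'm, 'x) cat_data_scheme \<Rightarrow> 'm \<Rightarrow> nat \<Rightarrow> 'm" where
  "mpow C f 0 = Id C (Dom C f)"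
| "mpow C f (Suc n) = f \<Zcomp>\<^bsub>C\<^esub> mpow C f n"

locale category =
  fixes C :: "('o, 'm, 'x) cat_data_scheme" (structure)
  assumes Dom_Obj: "f \<in> Arr C \<Longrightarrow> Dom C f \<in> Obj C"
    and Cod_Obj: "f \<in> Arr C \<Longrightarrow> Cod C f \<in> Obj C"
    and Id_hom: "A \<in> Obj C \<Longrightarrow> Id C A \<in> hom C A A"
    and Comp_hom: "f \<in> hom C A B \<Longrightarrow> g \<in> hom C B D \<Longrightarrow> f \<Zcomp> g \<in> hom C A D"
    and Id_Comp: "f \<in> hom C A B \<Longrightarrow> Id C A \<Zcomp> f = f"
    and Comp_Id: "f \<in> hom C A B \<Longrightarrow> f \<Zcomp> Id C B = f"
    and Comp_assoc: "f \<in> hom C A B \<Longrightarrow> g \<in> hom C B D \<Longrightarrow> h \<in> hom C D E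
      \<Longrightarrow> (f \<Zcomp> g) \<Zcomp> h = f \<Zcomp> (g \<Zcomp> h)"

record ('o, 'm) rcat_data = "('o, 'm) cat_data" +
  Rst :: "'m \<Rightarrow> 'm"

locale restriction_category = category C
  for C :: "('o, 'm, 'x) rcat_data_scheme" (structure) +
  assumes Rst_hom: "f \<in> hom C A B \<Longrightarrow> Rst C f \<in> hom C A A"
    and Rst_Comp: "f \<in> hom C A B \<Longrightarrow> Rst C f \<Zcomp> f = f"
    and Rst_commute: "f \<in> hom C A B \<Longrightarrow> g \<in> hom C A D
      \<Longrightarrow> Rst C f \<Zcomp> Rst C g = Rst C g \<Zcomp> Rst C f"
    and Rst_Rst_Comp: "f \<in> hom C A B \<Longrightarrow> g \<in> hom C A D
      \<Longrightarrow> Rst C (Rst C g \<Zcomp> f) = Rst C g \<Zcomp> Rst C f"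
    and Comp_Rst: "f \<in> hom C A B \<Longrightarrow> g \<in> hom C B D
      \<Longrightarrow> f \<Zcomp> Rst C g = Rst C (f \<Zcomp> g) \<Zcomp> f"

definition rle :: "('o, 'm, 'x) rcat_data_scheme \<Rightarrow> 'm \<Rightarrow> 'm \<Rightarrow> bool"
    ("(_ \<preceq>\<index> _)" [51, 51] 50) where
  "f \<preceq>\<^bsub>C\<^esub> g \<longleftrightarrow>
     (\<exists>A B. f \<in> hom C A B \<and> g \<in> hom C A B \<and> Rst C f \<Zcomp>\<^bsub>C\<^esub> g = f)"

record ('o, 'm) pcat_data = "('o, 'm) rcat_data" +
  Zero :: "'o \<Rightarrow> 'o \<Rightarrow> 'm"
  Perp :: "'m \<Rightarrow> 'm \<Rightarrow> bool"  (infix "\<bottom>\<index>" 50)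

locale restriction_zero_category = restriction_category C
  for C :: "('o, 'm, 'x) pcat_data_scheme" (structure) +
  assumes Zero_hom: "A \<in> Obj C \<Longrightarrow> B \<in> Obj C \<Longrightarrow> Zero C A B \<in> hom C A B"
    and Comp_Zero: "f \<in> hom C A B \<Longrightarrow> D \<in> Obj C \<Longrightarrow> f \<Zcomp> Zero C B D = Zero C A D"
    and Zero_Comp: "f \<in> hom C A B \<Longrightarrow> D \<in> Obj C \<Longrightarrow> Zero C D A \<Zcomp> f = Zero C D B"
    and Rst_Zero: "A \<in> Obj C \<Longrightarrow> B \<in> Obj C \<Longrightarrow> Rst C (Zero C A B) = Zero C A A"

locale perp_restriction_category = restriction_zero_category C
  for C :: "('o, 'm, 'x) pcat_data_scheme" (structure) +
  assumes Perp_Arr: "f \<bottom> g \<Longrightarrow> f \<in> Arr C \<and> g \<in> Arr C \<and> Dom C f = Dom C g"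
    and Perp_Id_Zero: "A \<in> Obj C \<Longrightarrow> B \<in> Obj C \<Longrightarrow> Id C A \<bottom> Zero C A B"
    and Perp_sym: "f \<bottom> g \<Longrightarrow> g \<bottom> f"
    and Perp_self: "f \<bottom> f \<Longrightarrow> f = Zero C (Dom C f) (Cod C f)"
    and Perp_down: "f' \<bottom> g' \<Longrightarrow> f \<preceq> f' \<Longrightarrow> g \<preceq> g' \<Longrightarrow> f \<bottom> g"
    and Perp_Comp: "f \<bottom> g \<Longrightarrow> f \<in> hom C X A \<Longrightarrow> g \<in> hom C X B \<Longrightarrow> h \<in> hom C W X
      \<Longrightarrow> k \<in> hom C A A' \<Longrightarrow> k' \<in> hom C B B' \<Longrightarrow> h \<Zcomp> f \<Zcomp> k \<bottom> h \<Zcomp> g \<Zcomp> k'"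
    and Perp_Rst: "f \<bottom> g \<Longrightarrow> Rst C f \<bottom> Rst C g"

(* The hom-set is an explicit argument so that the empty family is covered. Disjointness is
   demanded of different indices, so a map occurring twice in the family must be zero. *)
definition is_perp_join ::
    "('o, 'm, 'x) pcat_data_scheme \<Rightarrow> 'o \<Rightarrow> 'o \<Rightarrow> 'i set \<Rightarrow> ('i \<Rightarrow> 'm) \<Rightarrow> 'm \<Rightarrow> bool" where
  "is_perp_join C A B I F j \<longleftrightarrow>
     (\<forall>i\<in>I. F i \<in> hom C A B) \<and>
     (\<forall>i\<in>I. \<forall>i'\<in>I. i \<noteq> i' \<longrightarrow> F i \<bottom>\<^bsub>C\<^esub> F i') \<and>
     j \<in> hom C A B \<and>
     (\<forall>i\<in>I. F i \<preceq>\<^bsub>C\<^esub> j) \<and>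
     (\<forall>u\<in>hom C A B. (\<forall>i\<in>I. F i \<preceq>\<^bsub>C\<^esub> u) \<longrightarrow> j \<preceq>\<^bsub>C\<^esub> u)"

definition is_binary_join :: "('o, 'm, 'x) pcat_data_scheme \<Rightarrow> 'm \<Rightarrow> 'm \<Rightarrow> 'm \<Rightarrow> bool" where
  "is_binary_join C f g j \<longleftrightarrow>
     is_perp_join C (Dom C f) (Cod C f) UNIV (\<lambda>b::bool. if b then f else g) j"

definition binary_join :: "('o, 'm, 'x) pcat_data_scheme \<Rightarrow> 'm \<Rightarrow> 'm \<Rightarrow> 'm"
    (infixl "\<squnion>\<index>" 65) where
  "f \<squnion>\<^bsub>C\<^esub> g = (THE j. is_binary_join C f g j)"

lemma (in restriction_category) rle_antisym:
  assumes "f \<preceq> g" "g \<preceq> f"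
  shows "f = g"
proof -
  obtain A B where h: "f \<in> hom C A B" "g \<in> hom C A B" and fg: "Rst C f \<Zcomp> g = f"
    using assms(1) unfolding rle_def by blast
  have gf: "Rst C g \<Zcomp> f = g"
    using assms(2) unfolding rle_def by blast
  note r = Rst_hom[OF h(1)] Rst_hom[OF h(2)]
  have "f = Rst C f \<Zcomp> (Rst C g \<Zcomp> f)"
    using fg gf by simp
  also have "\<dots> = Rst C g \<Zcomp> (Rst C f \<Zcomp> f)"
    using Comp_assoc[OF r h(1)] Comp_assoc[OF r(2,1) h(1)] Rst_commute[OF h] by simp
  also have "\<dots> = g"
    using Rst_Comp[OF h(1)] gf by simp
  finally show ?thesis .
qed

lemma is_perp_join_unique:
  assumes "restriction_category C" "is_perp_join C A B I F j" "is_perp_join C A B I F j'"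
  shows "j = j'"
  using assms restriction_category.rle_antisym[of C j j'] unfolding is_perp_join_def by blast

locale binary_perp_joins = perp_restriction_category C
  for C :: "('o, 'm, 'x) pcat_data_scheme" (structure) +
  assumes binary_join_exists:
      "f \<in> hom C A B \<Longrightarrow> g \<in> hom C A B \<Longrightarrow> f \<bottom> g \<Longrightarrow> \<exists>j. is_binary_join C f g j"
    and Comp_binary_join: "f \<in> hom C A B \<Longrightarrow> g \<in> hom C A B \<Longrightarrow> f \<bottom> g \<Longrightarrow> h \<in> hom C W A
      \<Longrightarrow> h \<Zcomp> (f \<squnion> g) = (h \<Zcomp> f) \<squnion> (h \<Zcomp> g)"

locale perp_itegory = binary_perp_joins C
  for C :: "('o, 'm, 'x) pcat_data_scheme" (structure) +
  fixes wand :: "'m \<Rightarrow> 'm \<Rightarrow> 'm"  (infixl "\<circledast>" 60)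
  assumes wand_hom:
      "f \<in> hom C X X \<Longrightarrow> g \<in> hom C X A \<Longrightarrow> f \<bottom> g \<Longrightarrow> f \<circledast> g \<in> hom C X A"
    and wand_unfold: "f \<in> hom C X X \<Longrightarrow> g \<in> hom C X A \<Longrightarrow> f \<bottom> g
      \<Longrightarrow> g \<squnion> (f \<Zcomp> (f \<circledast> g)) = f \<circledast> g"
    and wand_natural: "f \<in> hom C X X \<Longrightarrow> g \<in> hom C X A \<Longrightarrow> f \<bottom> g \<Longrightarrow> h \<in> hom C A B
      \<Longrightarrow> (f \<circledast> g) \<Zcomp> h = f \<circledast> (g \<Zcomp> h)"
    and wand_dinatural: "f \<in> hom C X Y \<Longrightarrow> g \<in> hom C X A \<Longrightarrow> k \<in> hom C Y X \<Longrightarrow> f \<bottom> g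
      \<Longrightarrow> (k \<Zcomp> f) \<circledast> (k \<Zcomp> g) = k \<Zcomp> ((f \<Zcomp> k) \<circledast> g)"
    and wand_diagonal_Perp: "f \<in> hom C X X \<Longrightarrow> f' \<in> hom C X X \<Longrightarrow> g \<in> hom C X A
      \<Longrightarrow> f \<bottom> f' \<Longrightarrow> f \<squnion> f' \<bottom> g \<Longrightarrow> (f \<circledast> f') \<bottom> (f \<circledast> g)"
    and wand_diagonal: "f \<in> hom C X X \<Longrightarrow> f' \<in> hom C X X \<Longrightarrow> g \<in> hom C X A
      \<Longrightarrow> f \<bottom> f' \<Longrightarrow> f \<squnion> f' \<bottom> g
      \<Longrightarrow> (f \<squnion> f') \<circledast> g = (f \<circledast> f') \<circledast> (f \<circledast> g)"

end

theory Submission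
  imports Defs
begin

text \<open>For \<open>n < m\<close> both \<open>f\<^sup>n g\<close> and \<open>f\<^sup>m h\<close> factor through \<open>f\<^sup>n\<close>, followed by \<open>g\<close> and by \<open>f\<close>
  respectively, so disjointness reduces to \<open>f \<bottom> g\<close>. The join formula needs only the unfolding law
  of the wand, so it holds for every solution \<open>h\<close> of \<open>g \<squnion> f h = h\<close>: composing this equation with
  \<open>f\<^sup>n\<close> exhibits \<open>f\<^sup>n h\<close> as the join of \<open>f\<^sup>n g\<close> and \<open>f\<^bsup>n+1\<^esup> h\<close>, and telescoping these joins
  gives both the upper and the least bound property.\<close>

context category
begin

lemma
  assumes "f \<in> hom C A B"
  shows hom_Dom_Obj: "A \<in> Obj C" and hom_Cod_Obj: "B \<in> Obj C"
  using assms Dom_Obj Cod_Obj unfolding hom_def by auto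

lemma mpow_0_eq_Id:
  assumes "f \<in> hom C X Y"
  shows "mpow C f 0 = Id C X"
  using assms unfolding hom_def by simp

lemma mpow_hom:
  assumes f: "f \<in> hom C X X"
  shows "mpow C f n \<in> hom C X X"
proof (induction n)
  case 0
  show ?case
    unfolding mpow_0_eq_Id[OF f] using Id_hom[OF hom_Dom_Obj[OF f]] .
next
  case (Suc n)
  then show ?case
    using Comp_hom[OF f] by simp
qed

lemma mpow_Comp_hom:
  assumes "f \<in> hom C X X" "h \<in> hom C X B"
  shows "mpow C f n \<Zcomp> h \<in> hom C X B"
  using Comp_hom[OF mpow_hom] assms .

lemma mpow_0_Comp:
  assumes "f \<in> hom C X X" "h \<in> hom C X B"
  shows "mpow C f 0 \<Zcomp> h = h"
  unfolding mpow_0_eq_Id[OF assms(1)] using Id_Comp[OF assms(2)] .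

lemma mpow_Suc_Comp:
  assumes "f \<in> hom C X X" "h \<in> hom C X B"
  shows "mpow C f (Suc n) \<Zcomp> h = f \<Zcomp> (mpow C f n \<Zcomp> h)"
  using Comp_assoc[OF assms(1) mpow_hom[OF assms(1)] assms(2)] by simp

end

declare mpow.simps [simp del]

context restriction_category
begin

lemma rle_hom:
  assumes "f \<preceq> g"
  shows "f \<in> hom C A B \<longleftrightarrow> g \<in> hom C A B"
  using assms unfolding rle_def hom_def by auto

lemma rle_refl:
  assumes "f \<in> hom C A B"
  shows "f \<preceq> f"
  using assms Rst_Comp unfolding rle_def by blast

lemma rle_trans:
  assumes "f \<preceq> g" "g \<preceq> h"
  shows "f \<preceq> h"
proof -
  obtain A B where f: "f \<in> hom C A B" and g: "g \<in> hom C A B" and fg: "Rst C f \<Zcomp> g = f"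
    using assms(1) unfolding rle_def by blast
  have h: "h \<in> hom C A B" and gh: "Rst C g \<Zcomp> h = g"
    using g rle_hom[OF assms(2)] assms(2) unfolding rle_def by auto
  have "Rst C f \<Zcomp> h = (Rst C f \<Zcomp> Rst C g) \<Zcomp> h"
    using Rst_Rst_Comp[OF g f] fg by simp
  also have "\<dots> = Rst C f \<Zcomp> (Rst C g \<Zcomp> h)"
    using Comp_assoc[OF Rst_hom[OF f] Rst_hom[OF g] h] .
  also have "\<dots> = f"
    using fg gh by simp
  finally show ?thesis
    using f h unfolding rle_def by blast
qed

end

context perp_restriction_category
begin

lemma Perp_Comp_left:
  assumes f: "f \<in> hom C X A" and g: "g \<in> hom C X B" and "f \<bottom> g" and h: "h \<in> hom C W X"
  shows "h \<Zcomp> f \<bottom> h \<Zcomp> g"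
proof -
  have "h \<Zcomp> f \<Zcomp> Id C A \<bottom> h \<Zcomp> g \<Zcomp> Id C B"
    using Perp_Comp[OF \<open>f \<bottom> g\<close> f g h Id_hom[OF hom_Cod_Obj[OF f]] Id_hom[OF hom_Cod_Obj[OF g]]] .
  then show ?thesis
    using Comp_Id[OF Comp_hom[OF h f]] Comp_Id[OF Comp_hom[OF h g]] by simp
qed

lemma Perp_Comp_right:
  assumes f: "f \<in> hom C X A" and g: "g \<in> hom C X B" and "f \<bottom> g" and k: "k \<in> hom C B D"
  shows "f \<bottom> g \<Zcomp> k"
proof -
  have X: "X \<in> Obj C"
    using hom_Dom_Obj[OF f] .
  have "Id C X \<Zcomp> f \<Zcomp> Id C A \<bottom> Id C X \<Zcomp> g \<Zcomp> k"
    using Perp_Comp[OF \<open>f \<bottom> g\<close> f g Id_hom[OF X] Id_hom[OF hom_Cod_Obj[OF f]] k] .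
  then show ?thesis
    using Id_Comp[OF f] Id_Comp[OF g] Comp_Id[OF f] by simp
qed

lemma mpow_Comp_Perp:
  assumes f: "f \<in> hom C X X" and g: "g \<in> hom C X A" and "f \<bottom> g"
    and h: "h \<in> hom C X B" and "n < m"
  shows "mpow C f n \<Zcomp> g \<bottom> mpow C f m \<Zcomp> h"
  using \<open>n < m\<close>
proof (induction n arbitrary: m)
  case 0
  then obtain k where "m = Suc k"
    using gr0_implies_Suc by blast
  moreover have "g \<bottom> f \<Zcomp> (mpow C f k \<Zcomp> h)"
    using Perp_Comp_right[OF g f Perp_sym[OF \<open>f \<bottom> g\<close>] mpow_Comp_hom[OF f h]] .
  ultimately show ?case
    using mpow_0_Comp[OF f g] mpow_Suc_Comp[OF f h] by simp
next
  case (Suc n)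
  then obtain k where m: "m = Suc k" and "n < k"
    by (auto simp: Suc_less_eq2)
  have "f \<Zcomp> (mpow C f n \<Zcomp> g) \<bottom> f \<Zcomp> (mpow C f k \<Zcomp> h)"
    using Perp_Comp_left[OF mpow_Comp_hom[OF f g] mpow_Comp_hom[OF f h] Suc.IH[OF \<open>n < k\<close>] f] .
  then show ?case
    using m mpow_Suc_Comp[OF f g] mpow_Suc_Comp[OF f h] by simp
qed

lemma mpow_Comp_Perp_neq:
  assumes "f \<in> hom C X X" "g \<in> hom C X A" "f \<bottom> g" "n \<noteq> m"
  shows "mpow C f n \<Zcomp> g \<bottom> mpow C f m \<Zcomp> g"
  using \<open>n \<noteq> m\<close> mpow_Comp_Perp[OF assms(1-3,2)] Perp_sym by (metis linorder_neqE_nat)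

end

context binary_perp_joins
begin

lemma is_perp_join_binary_join:
  assumes "f \<in> hom C A B" "g \<in> hom C A B" "f \<bottom> g"
  shows "is_perp_join C A B UNIV (\<lambda>b. if b then f else g) (f \<squnion> g)"
proof -
  have join_iff: "is_binary_join C f g j \<longleftrightarrow>
      is_perp_join C A B UNIV (\<lambda>b. if b then f else g) j" for j
    using assms(1) unfolding is_binary_join_def hom_def by simp
  have "\<exists>!j. is_binary_join C f g j"
    using binary_join_exists[OF assms] is_perp_join_unique[OF restriction_category_axioms]
    unfolding join_iff by blast
  then have "is_binary_join C f g (f \<squnion> g)"
    unfolding binary_join_def by (rule theI')
  then show ?thesis
    unfolding join_iff .
qed

lemma
  assumes "f \<in> hom C A B" "g \<in> hom C A B" "f \<bottom> g"
  shows rle_binary_join1: "f \<preceq> f \<squnion> g"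
    and rle_binary_join2: "g \<preceq> f \<squnion> g"
    and binary_join_least: "f \<preceq> u \<Longrightarrow> g \<preceq> u \<Longrightarrow> f \<squnion> g \<preceq> u"
proof -
  note join = is_perp_join_binary_join[OF assms]
  have upper: "(if b then f else g) \<preceq> f \<squnion> g" for b
    using join unfolding is_perp_join_def by blast
  show "f \<preceq> f \<squnion> g" "g \<preceq> f \<squnion> g"
    using upper[of True] upper[of False] by simp_all
  assume "f \<preceq> u" "g \<preceq> u"
  then show "f \<squnion> g \<preceq> u"
    using join assms(1) rle_hom[of f u] unfolding is_perp_join_def by simp
qed

context
  fixes f g h X A
  assumes f: "f \<in> hom C X X" and g: "g \<in> hom C X A" and Perp: "f \<bottom> g"
    and h: "h \<in> hom C X A" and fixpoint: "g \<squnion> (f \<Zcomp> h) = h"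
begin

lemmas mpow_Comp_summands =
  mpow_Comp_hom[OF f g] mpow_Comp_hom[OF f h] mpow_Comp_Perp[OF f g Perp h lessI]

lemma mpow_Comp_fixpoint_unfold:
  "mpow C f n \<Zcomp> h = (mpow C f n \<Zcomp> g) \<squnion> (mpow C f (Suc n) \<Zcomp> h)"
proof (induction n)
  case 0
  show ?case
    unfolding mpow_Suc_Comp[OF f h] mpow_0_Comp[OF f g] mpow_0_Comp[OF f h] fixpoint ..
next
  case (Suc n)
  have "mpow C f (Suc n) \<Zcomp> h = f \<Zcomp> ((mpow C f n \<Zcomp> g) \<squnion> (mpow C f (Suc n) \<Zcomp> h))"
    using mpow_Suc_Comp[OF f h, of n] Suc.IH by simp
  also have "\<dots> = (f \<Zcomp> (mpow C f n \<Zcomp> g)) \<squnion> (f \<Zcomp> (mpow C f (Suc n) \<Zcomp> h))"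
    using Comp_binary_join[OF mpow_Comp_summands f] .
  also have "\<dots> = (mpow C f (Suc n) \<Zcomp> g) \<squnion> (mpow C f (Suc (Suc n)) \<Zcomp> h)"
    unfolding mpow_Suc_Comp[OF f g, of n] mpow_Suc_Comp[OF f h, of "Suc n"] ..
  finally show ?case .
qed

lemma mpow_Comp_fixpoint_rle: "mpow C f n \<Zcomp> h \<preceq> h"
proof (induction n)
  case 0
  show ?case
    using rle_refl[OF h] mpow_0_Comp[OF f h] by simp
next
  case (Suc n)
  have "mpow C f (Suc n) \<Zcomp> h \<preceq> mpow C f n \<Zcomp> h"
    unfolding mpow_Comp_fixpoint_unfold[of n] by (rule rle_binary_join2[OF mpow_Comp_summands])
  then show ?case
    using rle_trans Suc.IH by blast
qed

lemma mpow_Comp_rle_fixpoint: "mpow C f n \<Zcomp> g \<preceq> h"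
proof -
  have "mpow C f n \<Zcomp> g \<preceq> mpow C f n \<Zcomp> h"
    unfolding mpow_Comp_fixpoint_unfold[of n] by (rule rle_binary_join1[OF mpow_Comp_summands])
  then show ?thesis
    using rle_trans mpow_Comp_fixpoint_rle by blast
qed

lemma fixpoint_rleI:
  assumes "\<And>i. i < n \<Longrightarrow> mpow C f i \<Zcomp> g \<preceq> u" and "mpow C f n \<Zcomp> h \<preceq> u"
  shows "h \<preceq> u"
  using assms
proof (induction n)
  case 0
  then show ?case
    using mpow_0_Comp[OF f h] by simp
next
  case (Suc n)
  have "mpow C f n \<Zcomp> h \<preceq> u"
    unfolding mpow_Comp_fixpoint_unfold[of n]
    using Suc.prems by (intro binary_join_least[OF mpow_Comp_summands]) auto
  then show ?case
    using Suc.IH Suc.prems(1) by simp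
qed

lemma is_perp_join_fixpoint:
  "is_perp_join C X A {..n} (\<lambda>i. if i < n then mpow C f i \<Zcomp> g else mpow C f n \<Zcomp> h) h"
  (is "is_perp_join C X A _ ?F h")
  unfolding is_perp_join_def
proof (intro conjI ballI impI)
  fix i
  show "?F i \<in> hom C X A"
    using mpow_Comp_hom[OF f] g h by simp
  show "?F i \<preceq> h"
    using mpow_Comp_rle_fixpoint mpow_Comp_fixpoint_rle by simp
next
  have F_Perp: "?F i \<bottom> ?F j" if "i < j" "j \<le> n" for i j
    using that mpow_Comp_Perp[OF f g Perp] g h by simp
  fix i j assume "i \<in> {..n}" "j \<in> {..n}" "i \<noteq> j"
  then consider "i < j" "j \<le> n" | "j < i" "i \<le> n"
    by fastforce
  then show "?F i \<bottom> ?F j"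
    using F_Perp[of i j] Perp_sym[OF F_Perp[of j i]] by cases
next
  show "h \<in> hom C X A"
    by (fact h)
next
  fix u assume F_rle: "\<forall>i\<in>{..n}. ?F i \<preceq> u"
  show "h \<preceq> u"
  proof (rule fixpoint_rleI)
    show "mpow C f i \<Zcomp> g \<preceq> u" if "i < n" for i
      using F_rle[rule_format, of i] that by simp
    show "mpow C f n \<Zcomp> h \<preceq> u"
      using F_rle[rule_format, of n] by simp
  qed
qed

end

end

theorem lemma5p3:
  fixes C :: "('o, 'm, 'x) pcat_data_scheme" and X A :: 'o and f g :: 'm
  assumes "perp_restriction_category C"
    and "f \<in> hom C X X" and "g \<in> hom C X A" and "f \<bottom>\<^bsub>C\<^esub> g"
  shows "(\<forall>n m. n \<noteq> m \<longrightarrow> mpow C f n \<Zcomp>\<^bsub>C\<^esub> g \<bottom>\<^bsub>C\<^esub> mpow C f m \<Zcomp>\<^bsub>C\<^esub> g) \<and>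
    (\<forall>wand. perp_itegory C wand \<longrightarrow>
      (\<forall>n. is_perp_join C X A {..Suc n}
        (\<lambda>i. if i \<le> n then mpow C f i \<Zcomp>\<^bsub>C\<^esub> g else mpow C f (Suc n) \<Zcomp>\<^bsub>C\<^esub> wand f g)
        (wand f g)) \<and>
      (\<forall>n. mpow C f n \<Zcomp>\<^bsub>C\<^esub> g \<preceq>\<^bsub>C\<^esub> wand f g))"
proof (intro conjI allI impI)
  interpret perp_restriction_category C
    by fact
  show "mpow C f n \<Zcomp>\<^bsub>C\<^esub> g \<bottom>\<^bsub>C\<^esub> mpow C f m \<Zcomp>\<^bsub>C\<^esub> g" if "n \<noteq> m" for n m
    using mpow_Comp_Perp_neq[OF assms(2-4) that] .
next
  fix wand n
  assume "perp_itegory C wand"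
  then interpret perp_itegory C wand .
  note fixpoint = assms(2-4) wand_hom[OF assms(2-4)] wand_unfold[OF assms(2-4)]
  show "is_perp_join C X A {..Suc n}
      (\<lambda>i. if i \<le> n then mpow C f i \<Zcomp>\<^bsub>C\<^esub> g else mpow C f (Suc n) \<Zcomp>\<^bsub>C\<^esub> wand f g) (wand f g)"
    using is_perp_join_fixpoint[OF fixpoint, of "Suc n"] by (simp only: less_Suc_eq_le)
  show "mpow C f n \<Zcomp>\<^bsub>C\<^esub> g \<preceq>\<^bsub>C\<^esub> wand f g"
    using mpow_Comp_rle_fixpoint[OF fixpoint] .
qed

end
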